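(* Let $\phi\in\mathcal{L}$. If $\phi$ is satisfied in some topological model, then $\phi$ is satisfied in a finite topological model. That is, if there are a topological model $\langle X,\mathcal{T},i\rangle$, $U\in\mathcal{T}$ and $x\in U$ with $x,U\models\phi$, then there are a topological model $\langle X',\mathcal{T}',i'\rangle$ with $X'$ finite, $U'\in\mathcal{T}'$ and $x'\in U'$ with $x',U'\models\phi$.
   Context: Language: $\mathsf{A}$ is a countable set of atomic formulae with two distinguished elements $\top,\bot$. $\mathcal{L}$ is the least set containing $\mathsf{A}$ and closed under $\phi\land\psi$, $\neg\phi$, $\Box\phi$, $\mathsf{K}\phi$. A topological model is a triple $\langle X,\mathcal{T},i\rangle$ with $\mathcal{T}$ a topology on the set $X$ and $i:\mathsf{A}\to\mathcal{P}(X)$ with $i(\top)=X$, $i(\bot)=\emptyset$. Satisfaction is defined for pairs $(x,U)$ with $x\in U\in\mathcal{T}$: $x,U\models A$ iff $x\in i(A)$ for atomic $A$; Boolean connectives as usual; $x,U\models\mathsf{K}\phi$ iff $y,U\models\phi$ for all $y\in U$; $x,U\models\Box\phi$ iff $x,V\models\phi$ for all $V\in\mathcal{T}$ with $x\in V\subseteq U$. *)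

theory Defs
  imports "HOL-Analysis.Analysis"
begin

datatype 'p fm =
    Atom 'p
  | Conj "'p fm" "'p fm"
  | Neg "'p fm"
  | Box "'p fm"
  | Know "'p fm"

(* The carrier X of a model is topspace T.  The parameters tt and ff are the two
   distinguished atoms (truth and falsity); they are ordinary elements of the type of
   atoms, so their meaning is fixed by the interpretation i and not by the syntax. *)
definition topological_model ::
    "'p \<Rightarrow> 'p \<Rightarrow> 'a topology \<Rightarrow> ('p \<Rightarrow> 'a set) \<Rightarrow> bool" where
  "topological_model tt ff T i \<longleftrightarrow>
     (\<forall>p. i p \<subseteq> topspace T) \<and> i tt = topspace T \<and> i ff = {}"

(* Meaningful only for pairs with x \<in> U and openin T U.  Started from such a pair, the
   recursion only visits such pairs; every use below is guarded accordingly. *)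
primrec sat ::
    "'a topology \<Rightarrow> ('p \<Rightarrow> 'a set) \<Rightarrow> 'a \<Rightarrow> 'a set \<Rightarrow> 'p fm \<Rightarrow> bool" where
  "sat T i x U (Atom p) \<longleftrightarrow> x \<in> i p"
| "sat T i x U (Conj \<phi> \<psi>) \<longleftrightarrow> sat T i x U \<phi> \<and> sat T i x U \<psi>"
| "sat T i x U (Neg \<phi>) \<longleftrightarrow> \<not> sat T i x U \<phi>"
| "sat T i x U (Box \<phi>) \<longleftrightarrow> (\<forall>V. openin T V \<and> x \<in> V \<and> V \<subseteq> U \<longrightarrow> sat T i x V \<phi>)"
| "sat T i x U (Know \<phi>) \<longleftrightarrow> (\<forall>y\<in>U. sat T i y U \<phi>)"

definition satisfied_in ::
    "'a topology \<Rightarrow> ('p \<Rightarrow> 'a set) \<Rightarrow> 'p fm \<Rightarrow> bool" where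
  "satisfied_in T i \<phi> \<longleftrightarrow> (\<exists>U x. openin T U \<and> x \<in> U \<and> sat T i x U \<phi>)"

end

theory Submission
  imports Defs
begin

text \<open>
  For a finite family F of open sets, call two open sets equivalent if they are contained in the
  same members of F. By induction on the formula one finds a finite F such that, at a fixed
  point, the truth of each subformula depends only on the equivalence class of the open set.
  For \<open>K \<psi>\<close> one adds the interiors of the truth sets of \<open>\<psi>\<close> at the finitely many intersections
  of members of F; for \<open>\<box> \<psi>\<close> one adds the Heyting implications between such intersections and
  members of F. The finite model is then the quotient of X that identifies points lying in the
  same members of F and satisfying the same relevant atoms, with the quotient topology.
\<close>

section \<open>Open sets compared through a finite family, and stability of formulas\<close>

primrec subformulas :: "'p fm \<Rightarrow> 'p fm set" where
  "subformulas (Atom p) = {Atom p}"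
| "subformulas (Conj \<phi> \<psi>) = insert (Conj \<phi> \<psi>) (subformulas \<phi> \<union> subformulas \<psi>)"
| "subformulas (Neg \<phi>) = insert (Neg \<phi>) (subformulas \<phi>)"
| "subformulas (Box \<phi>) = insert (Box \<phi>) (subformulas \<phi>)"
| "subformulas (Know \<phi>) = insert (Know \<phi>) (subformulas \<phi>)"

lemma subformulas_refl [simp]: "\<phi> \<in> subformulas \<phi>"
  by (cases \<phi>) auto

definition same_bounds :: "'a set set \<Rightarrow> 'a set \<Rightarrow> 'a set \<Rightarrow> bool" where
  "same_bounds F V W \<longleftrightarrow> (\<forall>U\<in>F. V \<subseteq> U \<longleftrightarrow> W \<subseteq> U)"

lemma same_bounds_sym: "same_bounds F V W \<Longrightarrow> same_bounds F W V"
  by (auto simp: same_bounds_def)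

lemma same_bounds_trans: "same_bounds F V W \<Longrightarrow> same_bounds F W S \<Longrightarrow> same_bounds F V S"
  by (auto simp: same_bounds_def)

lemma same_bounds_mono: "same_bounds G V W \<Longrightarrow> F \<subseteq> G \<Longrightarrow> same_bounds F V W"
  by (auto simp: same_bounds_def)

text \<open>For \<open>V\<close> open and \<open>F\<close> a finite family of open sets, this is the
  largest open set with the same bounds in \<open>F\<close> as \<open>V\<close>, a canonical
  representative of its class. The factor \<open>topspace T\<close> covers the case that no member
  of \<open>F\<close> contains \<open>V\<close>, where the bare intersection would be
  \<open>UNIV\<close>.\<close>

definition hull_in :: "'a topology \<Rightarrow> 'a set set \<Rightarrow> 'a set \<Rightarrow> 'a set" where
  "hull_in T F V = topspace T \<inter> \<Inter>{U\<in>F. V \<subseteq> U}"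

lemma openin_hull_in:
  assumes "finite F" "\<And>U. U \<in> F \<Longrightarrow> openin T U"
  shows "openin T (hull_in T F V)"
proof (cases "{U\<in>F. V \<subseteq> U} = {}")
  case True
  then have "hull_in T F V = topspace T" unfolding hull_in_def by (simp only: Inf_empty Int_UNIV_right)
  then show ?thesis by simp
next
  case False
  with assms show ?thesis unfolding hull_in_def by (intro openin_Int openin_Inter) auto
qed

lemma finite_range_hull_in: "finite F \<Longrightarrow> finite (range (hull_in T F))"
  by (rule finite_subset[of _ "(\<lambda>G. topspace T \<inter> \<Inter>G) ` Pow F"]) (auto simp: hull_in_def)

lemma subset_hull_in: "openin T V \<Longrightarrow> V \<subseteq> hull_in T F V"
  using openin_subset[of T V] by (auto simp: hull_in_def)

lemma same_bounds_between_hull_in: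
  assumes "V \<subseteq> W" "W \<subseteq> hull_in T F V"
  shows "same_bounds F V W"
  using assms by (auto simp: same_bounds_def hull_in_def)

text \<open>One implication is enough because \<open>same_bounds\<close> is symmetric;
  \<open>stableD\<close> recovers the equivalence.\<close>

definition stable :: "'a topology \<Rightarrow> ('p \<Rightarrow> 'a set) \<Rightarrow> 'a set set \<Rightarrow> 'p fm \<Rightarrow> bool" where
  "stable T i F \<phi> \<longleftrightarrow> (\<forall>V W x. openin T V \<and> openin T W \<and> x \<in> V \<and> x \<in> W \<and> same_bounds F V W
      \<longrightarrow> sat T i x V \<phi> \<longrightarrow> sat T i x W \<phi>)"

lemma stableD:
  assumes "stable T i F \<phi>" "openin T V" "openin T W" "x \<in> V" "x \<in> W" "same_bounds F V W"
  shows "sat T i x V \<phi> \<longleftrightarrow> sat T i x W \<phi>"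
  using assms same_bounds_sym[OF assms(6)] unfolding stable_def by metis

lemma stable_mono: "stable T i F \<phi> \<Longrightarrow> F \<subseteq> G \<Longrightarrow> stable T i G \<phi>"
  unfolding stable_def by (metis same_bounds_mono)

text \<open>Stability of \<open>\<psi>\<close> allows evaluating it at the hull \<open>U\<close>
  instead of \<open>V\<close> or \<open>W\<close>. Knowledge at an open set then means inclusion in
  the truth set of \<open>\<psi>\<close> at \<open>U\<close>, equivalently in the interior of that
  set. This interior belongs to \<open>G\<close>, so \<open>V\<close> and \<open>W\<close> agree on
  it.\<close>

lemma stable_Know:
  assumes F: "finite F" "\<And>U. U \<in> F \<Longrightarrow> openin T U" and st: "stable T i F \<psi>"
  defines "G \<equiv> F \<union> (\<lambda>U. T interior_of {y\<in>U. sat T i y U \<psi>}) ` range (hull_in T F)"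
  shows "stable T i G (Know \<psi>)"
  unfolding stable_def
proof (intro allI impI, elim conjE)
  fix V W x
  assume V: "openin T V" and W: "openin T W" and VW: "same_bounds G V W"
    and sat: "sat T i x V (Know \<psi>)"
  define U where "U = hull_in T F V"
  have U: "openin T U" "V \<subseteq> U" "same_bounds F V U"
    using openin_hull_in[OF F] subset_hull_in[OF V] same_bounds_between_hull_in[of V U T F]
    by (auto simp: U_def)
  have WU: "same_bounds F W U"
    using U(3) same_bounds_mono[OF VW, of F] same_bounds_sym same_bounds_trans
    unfolding G_def by blast
  let ?I = "T interior_of {y\<in>U. sat T i y U \<psi>}"
  have "V \<subseteq> {y\<in>U. sat T i y U \<psi>}"
    using sat U stableD[OF st V U(1) _ _ U(3)] by auto
  then have "V \<subseteq> ?I" using V by (simp add: interior_of_maximal)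
  moreover have "?I \<in> G" by (auto simp: G_def U_def)
  ultimately have "W \<subseteq> ?I" using VW by (simp add: same_bounds_def)
  then have "W \<subseteq> {y\<in>U. sat T i y U \<psi>}" using interior_of_subset by fastforce
  then show "sat T i x W (Know \<psi>)"
    using stableD[OF st W U(1) _ _ WU] by auto
qed

text \<open>An open \<open>S\<close> around \<open>x\<close> below \<open>W\<close> is matched by
  \<open>V \<inter> U\<close> below \<open>V\<close>, where \<open>U\<close> is the hull of
  \<open>S\<close>. The sets \<open>V \<inter> U\<close> and \<open>W \<inter> U\<close> have the
  same bounds by the Heyting adjunction, and \<open>W \<inter> U\<close> has those of
  \<open>S\<close>.\<close>

lemma stable_Box:
  assumes F: "finite F" "\<And>U. U \<in> F \<Longrightarrow> openin T U" and st: "stable T i F \<psi>"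
  defines "G \<equiv> F \<union> (\<lambda>(A, B). T interior_of ((topspace T - A) \<union> B)) ` (range (hull_in T F) \<times> F)"
  shows "stable T i G (Box \<psi>)"
  unfolding stable_def
proof (intro allI impI, elim conjE)
  fix V W x
  assume V: "openin T V" and W: "openin T W" and x: "x \<in> V" and VW: "same_bounds G V W"
    and sat: "sat T i x V (Box \<psi>)"
  have "sat T i x S \<psi>" if S: "openin T S" "x \<in> S" "S \<subseteq> W" for S
  proof -
    define U where "U = hull_in T F S"
    have U: "openin T U" "S \<subseteq> U"
      using openin_hull_in[OF F] subset_hull_in[OF S(1)] by (auto simp: U_def)
    have "V \<inter> U \<subseteq> B \<longleftrightarrow> W \<inter> U \<subseteq> B" if B: "B \<in> F" for B
    proof -
      \<comment> \<open>\<open>?I\<close> is the Heyting implication from \<open>U\<close> to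
        \<open>B\<close> in the lattice of open sets: the largest open set whose intersection with
        \<open>U\<close> lies in \<open>B\<close>.\<close>
      let ?I = "T interior_of ((topspace T - U) \<union> B)"
      have *: "O' \<inter> U \<subseteq> B \<longleftrightarrow> O' \<subseteq> ?I" if "openin T O'" for O'
        using openin_subset[OF that] interior_of_subset[of T "(topspace T - U) \<union> B"]
          interior_of_maximal[of O' "(topspace T - U) \<union> B" T] that by blast
      have "?I \<in> G" using B by (auto simp: G_def U_def)
      then show ?thesis using *[OF V] *[OF W] VW by (simp add: same_bounds_def)
    qed
    then have 1: "same_bounds F (V \<inter> U) (W \<inter> U)" by (simp add: same_bounds_def)
    \<comment> \<open>\<open>W \<inter> U\<close> lies between \<open>S\<close> and its
      hull.\<close>
    have "same_bounds F S (W \<inter> U)"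
      using same_bounds_between_hull_in[of S "W \<inter> U" T F] S U by (auto simp: U_def)
    then have 2: "same_bounds F (V \<inter> U) S" using 1 same_bounds_sym same_bounds_trans by blast
    have VU: "openin T (V \<inter> U)" "x \<in> V \<inter> U" using V U S x by auto
    then have "sat T i x (V \<inter> U) \<psi>" using sat by auto
    then show ?thesis using stableD[OF st VU(1) S(1) VU(2) S(2) 2] by simp
  qed
  then show "sat T i x W (Box \<psi>)" by simp
qed

text \<open>Enlarging a family preserves stability, so each induction step keeps what was achieved
  for smaller formulas. The enlargements stay finite because a finite family has only finitely many
  hulls.\<close>

lemma finite_stable_family:
  fixes T :: "'a topology"
  shows "\<exists>F. finite F \<and> (\<forall>U\<in>F. openin T U) \<and> (\<forall>\<psi>\<in>subformulas \<phi>. stable T i F \<psi>)"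
proof (induction \<phi>)
  case (Atom p)
  show ?case by (intro exI[of _ "{}"]) (auto simp: stable_def)
next
  case (Conj \<phi>1 \<phi>2)
  then obtain F1 F2 where
    F1: "finite F1" "\<forall>U\<in>F1. openin T U" "\<forall>\<psi>\<in>subformulas \<phi>1. stable T i F1 \<psi>" and
    F2: "finite F2" "\<forall>U\<in>F2. openin T U" "\<forall>\<psi>\<in>subformulas \<phi>2. stable T i F2 \<psi>"
    by metis
  have "\<forall>\<psi>\<in>subformulas \<phi>1 \<union> subformulas \<phi>2. stable T i (F1 \<union> F2) \<psi>"
    using F1(3) F2(3) stable_mono by blast
  moreover from this have "stable T i (F1 \<union> F2) (Conj \<phi>1 \<phi>2)"
    unfolding stable_def by (metis UnI1 UnI2 sat.simps(2) subformulas_refl)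
  ultimately show ?case using F1 F2 by (intro exI[of _ "F1 \<union> F2"]) auto
next
  case (Neg \<phi>)
  then obtain F where
    F: "finite F" "\<forall>U\<in>F. openin T U" "\<forall>\<psi>\<in>subformulas \<phi>. stable T i F \<psi>" by blast
  have "stable T i F (Neg \<phi>)"
    using stableD[of T i F \<phi>] F(3) subformulas_refl unfolding stable_def[of _ _ _ "Neg \<phi>"]
    by (metis sat.simps(3))
  then show ?case using F by auto
next
  case (Box \<phi>)
  then obtain F where
    F: "finite F" "\<And>U. U \<in> F \<Longrightarrow> openin T U" "\<forall>\<psi>\<in>subformulas \<phi>. stable T i F \<psi>" by blast
  define G where
    "G = F \<union> (\<lambda>(A, B). T interior_of ((topspace T - A) \<union> B)) ` (range (hull_in T F) \<times> F)"
  have "stable T i G (Box \<phi>)"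
    unfolding G_def using F by (intro stable_Box) auto
  moreover have "\<forall>\<psi>\<in>subformulas \<phi>. stable T i G \<psi>"
    using F(3) stable_mono[of T i F _ G] by (auto simp: G_def)
  moreover have "finite G" "\<forall>U\<in>G. openin T U"
    using F(1,2) finite_range_hull_in[OF F(1)] by (auto simp: G_def)
  ultimately show ?case by (intro exI[of _ G]) auto
next
  case (Know \<phi>)
  then obtain F where
    F: "finite F" "\<And>U. U \<in> F \<Longrightarrow> openin T U" "\<forall>\<psi>\<in>subformulas \<phi>. stable T i F \<psi>" by blast
  define G where
    "G = F \<union> (\<lambda>U. T interior_of {y\<in>U. sat T i y U \<phi>}) ` range (hull_in T F)"
  have "stable T i G (Know \<phi>)"
    unfolding G_def using F by (intro stable_Know) auto
  moreover have "\<forall>\<psi>\<in>subformulas \<phi>. stable T i G \<psi>"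
    using F(3) stable_mono[of T i F _ G] by (auto simp: G_def)
  moreover have "finite G" "\<forall>U\<in>G. openin T U"
    using F(1,2) finite_range_hull_in[OF F(1)] by (auto simp: G_def)
  ultimately show ?case by (intro exI[of _ G]) auto
qed

section \<open>Quotient topologies and the truth of formulas in them\<close>

definition quotient_topology :: "'a topology \<Rightarrow> ('a \<Rightarrow> 'b) \<Rightarrow> 'b topology" where
  "quotient_topology T f =
     topology (\<lambda>S. S \<subseteq> f ` topspace T \<and> openin T {x \<in> topspace T. f x \<in> S})"

lemma openin_quotient_topology:
  "openin (quotient_topology T f) S \<longleftrightarrow>
     S \<subseteq> f ` topspace T \<and> openin T {x \<in> topspace T. f x \<in> S}"
proof -
  have "istopology (\<lambda>S. S \<subseteq> f ` topspace T \<and> openin T {x \<in> topspace T. f x \<in> S})"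
    unfolding istopology_def
  proof (intro conjI allI impI)
    fix A B
    assume "A \<subseteq> f ` topspace T \<and> openin T {x \<in> topspace T. f x \<in> A}"
      and "B \<subseteq> f ` topspace T \<and> openin T {x \<in> topspace T. f x \<in> B}"
    moreover have "{x \<in> topspace T. f x \<in> A \<inter> B} =
        {x \<in> topspace T. f x \<in> A} \<inter> {x \<in> topspace T. f x \<in> B}" by auto
    ultimately show "A \<inter> B \<subseteq> f ` topspace T" "openin T {x \<in> topspace T. f x \<in> A \<inter> B}"
      by (auto simp del: Int_iff)
  next
    fix K
    assume K: "\<forall>S\<in>K. S \<subseteq> f ` topspace T \<and> openin T {x \<in> topspace T. f x \<in> S}"
    then show "\<Union>K \<subseteq> f ` topspace T" by auto
    have "{x \<in> topspace T. f x \<in> \<Union>K} = (\<Union>S\<in>K. {x \<in> topspace T. f x \<in> S})" by auto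
    then show "openin T {x \<in> topspace T. f x \<in> \<Union>K}" using K by auto
  qed
  then show ?thesis by (simp add: quotient_topology_def topology_inverse')
qed

lemma topspace_quotient_topology [simp]: "topspace (quotient_topology T f) = f ` topspace T"
proof -
  have "{x \<in> topspace T. f x \<in> f ` topspace T} = topspace T" by auto
  then have "openin (quotient_topology T f) (f ` topspace T)"
    by (simp add: openin_quotient_topology)
  moreover have "topspace (quotient_topology T f) \<subseteq> f ` topspace T"
    using openin_topspace[of "quotient_topology T f"] unfolding openin_quotient_topology by blast
  ultimately show ?thesis using openin_subset by blast
qed

text \<open>The hard case is \<open>Box\<close>: an open set around \<open>x\<close> need not be a
  preimage under \<open>f\<close>. Its hull is one, since the members of \<open>F\<close> are unions
  of fibres within \<open>topspace T\<close>, and stability makes the change of open set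
  harmless.\<close>

lemma sat_quotient_topology:
  assumes F: "finite F" "\<And>U. U \<in> F \<Longrightarrow> openin T U"
    and saturated: "\<And>U x y. U \<in> F \<Longrightarrow> f x = f y \<Longrightarrow> x \<in> U \<Longrightarrow> y \<in> topspace T \<Longrightarrow> y \<in> U"
    and atoms: "\<And>p x. p \<in> set_fm \<phi> \<Longrightarrow> x \<in> topspace T \<Longrightarrow> f x \<in> i' p \<longleftrightarrow> x \<in> i p"
    and st: "\<forall>\<psi>\<in>subformulas \<phi>. stable T i F \<psi>"
    and "openin (quotient_topology T f) S" "x \<in> topspace T" "f x \<in> S"
  shows "sat (quotient_topology T f) i' (f x) S \<phi> \<longleftrightarrow>
         sat T i x {y \<in> topspace T. f y \<in> S} \<phi>"
  using atoms st assms(6-)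
proof (induction \<phi> arbitrary: x S)
  case (Box \<phi>)
  let ?Q = "quotient_topology T f" and ?pre = "\<lambda>S. {y \<in> topspace T. f y \<in> S}"
  have IH: "sat ?Q i' (f x) R \<phi> \<longleftrightarrow> sat T i x (?pre R) \<phi>"
    if "openin ?Q R" "f x \<in> R" for R
    using that Box.prems(1,2,4) by (intro Box.IH) auto
  have st: "stable T i F \<phi>" using Box.prems(2) by simp
  show ?case
  proof
    assume L: "sat ?Q i' (f x) S (Box \<phi>)"
    have "sat T i x W \<phi>" if W: "openin T W" "x \<in> W" "W \<subseteq> ?pre S" for W
    proof -
      define U where "U = hull_in T F W"
      \<comment> \<open>Intersecting with \<open>S\<close> keeps \<open>R\<close> below
        \<open>S\<close>, while \<open>?pre S \<inter> U\<close> still lies between \<open>W\<close>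
        and its hull \<open>U\<close>.\<close>
      define R where "R = S \<inter> f ` U"
      have U: "openin T U" "W \<subseteq> U"
        using openin_hull_in[OF F] subset_hull_in[OF W(1)] by (auto simp: U_def)
      have "?pre (f ` U) = U"
      proof
        show "U \<subseteq> ?pre (f ` U)" by (auto simp: U_def hull_in_def)
        show "?pre (f ` U) \<subseteq> U"
        proof
          fix y assume "y \<in> ?pre (f ` U)"
          then obtain z where z: "z \<in> U" "f z = f y" "y \<in> topspace T" by auto
          have "y \<in> B" if "B \<in> F" "W \<subseteq> B" for B
            using saturated[of B z y] z that by (auto simp: U_def hull_in_def)
          then show "y \<in> U" using z(3) by (auto simp: U_def hull_in_def)
        qed
      qed
      then have preR: "?pre R = ?pre S \<inter> U" by (auto simp: R_def)
      have pS: "openin T (?pre S)" "S \<subseteq> f ` topspace T"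
        using Box.prems(3) by (simp_all add: openin_quotient_topology)
      have R: "openin ?Q R" "f x \<in> R" "R \<subseteq> S"
        using pS U W(2,3) openin_Int[OF pS(1) U(1)] preR
        by (auto simp: openin_quotient_topology R_def)
      have "same_bounds F W (?pre R)"
        using W U by (intro same_bounds_between_hull_in[of _ _ T]) (auto simp: preR U_def[symmetric])
      moreover have "openin T (?pre R)" using R(1) by (simp add: openin_quotient_topology)
      moreover have "sat T i x (?pre R) \<phi>" using L R IH by auto
      ultimately show ?thesis
        using stableD[OF st W(1), of "?pre R" x] W(2) R(2) Box.prems(4) by auto
    qed
    then show "sat T i x (?pre S) (Box \<phi>)" by simp
  next
    assume "sat T i x (?pre S) (Box \<phi>)"
    \<comment> \<open>Preimages of open subsets of \<open>S\<close> are among the open sets that the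
      assumption quantifies over.\<close>
    then show "sat ?Q i' (f x) S (Box \<phi>)"
      using IH Box.prems(4) by (auto simp: openin_quotient_topology)
  qed
next
  case (Know \<phi>)
  have "sat (quotient_topology T f) i' (f y) S \<phi> \<longleftrightarrow> sat T i y {y \<in> topspace T. f y \<in> S} \<phi>"
    if "y \<in> topspace T" "f y \<in> S" for y
    using that Know.prems(1,2,3) by (intro Know.IH) auto
  \<comment> \<open>Every point of \<open>S\<close> is some \<open>f y\<close>, so the induction
    hypothesis reaches all of \<open>S\<close>.\<close>
  moreover have "S \<subseteq> f ` topspace T" using Know.prems(3) by (simp add: openin_quotient_topology)
  ultimately show ?case by auto
qed auto

section \<open>Construction of the finite model\<close>

lemma finite_separating_map:
  assumes "finite \<A>"
  obtains f :: "'a \<Rightarrow> nat" where "finite (range f)"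
    "\<And>A x y. A \<in> \<A> \<Longrightarrow> f x = f y \<Longrightarrow> x \<in> A \<Longrightarrow> y \<in> A"
proof -
  obtain g :: "'a set set \<Rightarrow> nat" where g: "inj_on g (Pow \<A>)"
    using finite_imp_inj_to_nat_seg[of "Pow \<A>"] assms by auto
  \<comment> \<open>A point is coded by the set of members of \<open>\<A>\<close> that contain it;
    \<open>g\<close> turns these finitely many sets into numbers.\<close>
  define f where "f x = g {A\<in>\<A>. x \<in> A}" for x
  show ?thesis
  proof (rule that)
    show "finite (range f)"
      by (rule finite_subset[of _ "g ` Pow \<A>"]) (auto simp: f_def assms)
    fix A x y
    assume "A \<in> \<A>" "f x = f y" "x \<in> A"
    moreover have "{A\<in>\<A>. x \<in> A} = {A\<in>\<A>. y \<in> A}"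
      using \<open>f x = f y\<close> unfolding f_def by (rule inj_onD[OF g]) auto
    ultimately show "y \<in> A" by blast
  qed
qed

lemma finite_set_fm: "finite (set_fm \<phi>)"
  by (induction \<phi>) auto

theorem theorem22:
  fixes tt ff :: "'p::countable"
    and \<phi> :: "'p fm"
    and T :: "'a topology"
    and i :: "'p \<Rightarrow> 'a set"
  assumes "tt \<noteq> ff"
    and "topological_model tt ff T i"
    and "satisfied_in T i \<phi>"
  shows "\<exists>(T' :: nat topology) (i' :: 'p \<Rightarrow> nat set).
           topological_model tt ff T' i' \<and> finite (topspace T') \<and> satisfied_in T' i' \<phi>"
proof -
  obtain U x where U: "openin T U" "x \<in> U" "sat T i x U \<phi>"
    using assms(3) by (auto simp: satisfied_in_def)
  have i: "\<And>p. i p \<subseteq> topspace T" "i tt = topspace T" "i ff = {}"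
    using assms(2) by (auto simp: topological_model_def)
  obtain F0 where F0: "finite F0" "\<forall>U\<in>F0. openin T U" "\<forall>\<psi>\<in>subformulas \<phi>. stable T i F0 \<psi>"
    using finite_stable_family[of T \<phi> i] by (elim exE conjE)
  define F where "F = insert U F0"
  have F: "finite F" "\<And>U. U \<in> F \<Longrightarrow> openin T U"
    using F0(1,2) U(1) by (auto simp: F_def)
  have st: "\<forall>\<psi>\<in>subformulas \<phi>. stable T i F \<psi>"
    using F0(3) stable_mono[of T i F0 _ F] unfolding F_def by blast
  \<comment> \<open>Including \<open>tt\<close> gives it the whole carrier as its interpretation in
    the quotient, even when it does not occur in \<open>\<phi>\<close>.\<close>
  define P where "P = set_fm \<phi> \<union> {tt, ff}"
  have "finite (F \<union> i ` P)" using F(1) by (simp add: P_def finite_set_fm)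
  then obtain f :: "'a \<Rightarrow> nat" where f: "finite (range f)"
    "\<And>A x y. A \<in> F \<union> i ` P \<Longrightarrow> f x = f y \<Longrightarrow> x \<in> A \<Longrightarrow> y \<in> A"
    by (rule finite_separating_map) blast
  \<comment> \<open>Atoms outside \<open>P\<close> do not occur in \<open>\<phi>\<close>; they
    receive the empty set as a default.\<close>
  define i' where "i' p = (if p \<in> P then f ` i p else {})" for p
  let ?Q = "quotient_topology T f"
  have "topological_model tt ff ?Q i'"
    using i by (auto simp: topological_model_def i'_def P_def)
  moreover have "finite (topspace ?Q)"
    using f(1) finite_subset[of "f ` topspace T" "range f"] by auto
  moreover have "satisfied_in ?Q i' \<phi>"
  proof -
    have f_image_iff: "f y \<in> f ` A \<longleftrightarrow> y \<in> A" if "A \<in> F \<union> i ` P" for A y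
    proof
      assume "f y \<in> f ` A"
      then obtain z where "z \<in> A" "f z = f y" by (metis imageE)
      then show "y \<in> A" using f(2)[OF that] by metis
    qed simp
    have "U \<in> F \<union> i ` P" by (simp add: F_def)
    then have pre: "{y \<in> topspace T. f y \<in> f ` U} = U"
      using openin_subset[OF U(1)] by (simp only: f_image_iff) blast
    have Q: "openin ?Q (f ` U)"
      unfolding openin_quotient_topology pre using U(1) openin_subset[OF U(1)] by (simp add: image_mono)
    have "sat ?Q i' (f x) (f ` U) \<phi> \<longleftrightarrow> sat T i x {y \<in> topspace T. f y \<in> f ` U} \<phi>"
    proof (rule sat_quotient_topology[OF F _ _ st Q])
      fix A y z
      assume "A \<in> F" "f y = f z" "y \<in> A"
      then show "z \<in> A" by (metis f(2) UnI1)
    next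
      fix p y
      assume "p \<in> set_fm \<phi>"
      then have "p \<in> P" by (simp add: P_def)
      then show "f y \<in> i' p \<longleftrightarrow> y \<in> i p"
        using f_image_iff[of "i p" y] by (simp add: i'_def)
    qed (use U openin_subset in blast)+
    then have "sat ?Q i' (f x) (f ` U) \<phi>" using U(3) by (simp only: pre)
    then show ?thesis unfolding satisfied_in_def using Q U(2) by blast
  qed
  ultimately show ?thesis by blast
qed

end
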